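(* Let $\mathcal{H}$ be a first-order hypersequent with no free variables that is valid in $[0,1]$-semantics. Then for every natural number $n$, the hypersequent $\mathcal{H}_{\frac{1}{n}}$ is derivable in the hypersequent calculus GŁ$\forall$.
   Context: Formulas of first-order Łukasiewicz logic are built over a first-order signature (function symbols, including constants, and relation symbols) from atomic formulas $R(t_1,\dots,t_k)$ and the constant $\bot$ using $\to$ and the existential quantifier $\exists$; $(\forall x)A$ abbreviates $\neg(\exists x)\neg A$, where $\neg A := A\to\bot$. A $[0,1]$-structure $\mathfrak{M}$ consists of a nonempty set $M$, functions $f^{\mathfrak{M}}:M^k\to M$ for $k$-ary function symbols, and functions $R^{\mathfrak{M}}:M^k\to[0,1]$ for $k$-ary relation symbols. Values of closed formulas (with parameters from $M$) are: $\bot^{\mathfrak{M}}=1$; $(A\to B)^{\mathfrak{M}}=\max(B^{\mathfrak{M}}-A^{\mathfrak{M}},0)$; $((\exists x)A)^{\mathfrak{M}}=\inf_{m\in M}(A[m/x])^{\mathfrak{M}}$. (Value $0$ means "fully true".) A sequent $\Gamma\Rightarrow\Delta$ consists of two finite multisets of formulas; a hypersequent is a finite multiset of sequents, written $\Gamma_1\Rightarrow\Delta_1\mid\cdots\mid\Gamma_k\Rightarrow\Delta_k$. Values: $(\Gamma\Rightarrow\Delta)^{\mathfrak{M}}=\sum_{A\in\Delta}A^{\mathfrak{M}}-\sum_{B\in\Gamma}B^{\mathfrak{M}}$ (ordinary real sums, counted with multiplicity), and the value of a hypersequent is the minimum of the values of its components. A hypersequent $\mathcal{H}$ with no free variables is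 valid if $\mathcal{H}^{\mathfrak{M}}\le 0$ for every $[0,1]$-structure $\mathfrak{M}$. Notation: $n\Gamma$ is the multiset union of $n$ copies of $\Gamma$; $\Gamma\Rightarrow_{\frac1n}\Delta$ denotes the sequent $\bot,n\Gamma\Rightarrow n\Delta$; if $\mathcal{H}=\Gamma_1\Rightarrow\Delta_1\mid\cdots\mid\Gamma_k\Rightarrow\Delta_k$ then $\mathcal{H}_{\frac1n}$ is $\Gamma_1\Rightarrow_{\frac1n}\Delta_1\mid\cdots\mid\Gamma_k\Rightarrow_{\frac1n}\Delta_k$. The calculus GŁ$\forall$ (in the rules, $\mathcal{G}$ is an arbitrary, possibly empty, side hypersequent) has: initial hypersequents $A\Rightarrow A$ (id), the empty sequent $\Rightarrow$, and $\bot\Rightarrow A$; structural rules: (ec) from $\mathcal{G}\mid\Gamma\Rightarrow\Delta\mid\Gamma\Rightarrow\Delta$ infer $\mathcal{G}\mid\Gamma\Rightarrow\Delta$; (ew) from $\mathcal{G}\mid\Gamma\Rightarrow\Delta$ infer $\mathcal{G}\mid\Gamma\Rightarrow\Delta\mid\Gamma'\Rightarrow\Delta'$; (split) from $\mathcal{G}\mid\Gamma_0,\Gamma_1\Rightarrow\Delta_0,\Delta_1$ infer $\mathcal{G}\mid\Gamma_0\Rightarrow\Delta_0\mid\Gamma_1\Rightarrow\Delta_1$; (mix) from $\mathcal{G}\mid\Gamma_0\Rightarrow\Delta_0$ and $\mathcal{G}\mid\Gamma_1\Rightarrow\Delta_1$ infer $\mathcal{G}\mid\Gamma_0,\Gamma_1\Rightarrow\Delta_0,\Delta_1$;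 (wl) from $\mathcal{G}\mid\Gamma\Rightarrow\Delta$ infer $\mathcal{G}\mid\Gamma,A\Rightarrow\Delta$; logical rules: ($\to\Rightarrow$) from $\mathcal{G}\mid\Gamma,B\Rightarrow A,\Delta\mid\Gamma\Rightarrow\Delta$ infer $\mathcal{G}\mid\Gamma,A\to B\Rightarrow\Delta$; ($\Rightarrow\to$) from $\mathcal{G}\mid\Gamma,A\Rightarrow B,\Delta$ and $\mathcal{G}\mid\Gamma\Rightarrow\Delta$ infer $\mathcal{G}\mid\Gamma\Rightarrow A\to B,\Delta$; ($\exists\Rightarrow$) from $\mathcal{G}\mid\Gamma,A(c)\Rightarrow\Delta$ infer $\mathcal{G}\mid\Gamma,(\exists x)A[x/c]\Rightarrow\Delta$, provided the variable $c$ does not occur free elsewhere in the conclusion; ($\Rightarrow\exists$) from $\mathcal{G}\mid\Gamma\Rightarrow A[t/x],\Delta$ infer $\mathcal{G}\mid\Gamma\Rightarrow(\exists x)A,\Delta$ for an arbitrary term $t$. *)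

theory Defs
  imports Complex_Main "HOL-Library.Multiset"
begin

record ('f, 'r) signature =
  funs :: "'f set"
  fun_arity :: "'f \<Rightarrow> nat"
  rels :: "'r set"
  rel_arity :: "'r \<Rightarrow> nat"

text \<open>Variables are de Bruijn indices, so formulas are identified up to renaming of bound
  variables; an index pointing beyond all enclosing quantifiers is a free variable.\<close>

datatype 'f tm = Var nat | Fun 'f "'f tm list"

datatype ('f, 'r) fm =
    Rel 'r "'f tm list"
  | Bot
  | Imp "('f, 'r) fm" "('f, 'r) fm"
  | Exists "('f, 'r) fm"

definition Neg :: "('f, 'r) fm \<Rightarrow> ('f, 'r) fm" where
  "Neg A = Imp A Bot"

definition Forall :: "('f, 'r) fm \<Rightarrow> ('f, 'r) fm" where
  "Forall A = Neg (Exists (Neg A))"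

type_synonym ('f, 'r) sequent = "('f, 'r) fm multiset \<times> ('f, 'r) fm multiset"
type_synonym ('f, 'r) hypersequent = "('f, 'r) sequent multiset"

primrec wf_tm :: "('f, 'r) signature \<Rightarrow> 'f tm \<Rightarrow> bool" where
  "wf_tm L (Var i) \<longleftrightarrow> True"
| "wf_tm L (Fun f ts) \<longleftrightarrow> f \<in> funs L \<and> length ts = fun_arity L f \<and> list_all (wf_tm L) ts"

primrec wf_fm :: "('f, 'r) signature \<Rightarrow> ('f, 'r) fm \<Rightarrow> bool" where
  "wf_fm L (Rel r ts) \<longleftrightarrow> r \<in> rels L \<and> length ts = rel_arity L r \<and> list_all (wf_tm L) ts"
| "wf_fm L Bot \<longleftrightarrow> True"
| "wf_fm L (Imp A B) \<longleftrightarrow> wf_fm L A \<and> wf_fm L B"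
| "wf_fm L (Exists A) \<longleftrightarrow> wf_fm L A"

definition wf_seq :: "('f, 'r) signature \<Rightarrow> ('f, 'r) sequent \<Rightarrow> bool" where
  "wf_seq L S \<longleftrightarrow> (\<forall>A \<in># fst S + snd S. wf_fm L A)"

definition wf_hyp :: "('f, 'r) signature \<Rightarrow> ('f, 'r) hypersequent \<Rightarrow> bool" where
  "wf_hyp L H \<longleftrightarrow> (\<forall>S \<in># H. wf_seq L S)"

primrec fv_tm :: "'f tm \<Rightarrow> nat set" where
  "fv_tm (Var i) = {i}"
| "fv_tm (Fun f ts) = \<Union> (set (map fv_tm ts))"

primrec fv_fm :: "('f, 'r) fm \<Rightarrow> nat set" where
  "fv_fm (Rel r ts) = \<Union> (set (map fv_tm ts))"
| "fv_fm Bot = {}"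
| "fv_fm (Imp A B) = fv_fm A \<union> fv_fm B"
| "fv_fm (Exists A) = {i. Suc i \<in> fv_fm A}"

definition fv_seq :: "('f, 'r) sequent \<Rightarrow> nat set" where
  "fv_seq S = (\<Union>A \<in> set_mset (fst S + snd S). fv_fm A)"

definition fv_hyp :: "('f, 'r) hypersequent \<Rightarrow> nat set" where
  "fv_hyp H = (\<Union>S \<in> set_mset H. fv_seq S)"

primrec subst_tm :: "(nat \<Rightarrow> 'f tm) \<Rightarrow> 'f tm \<Rightarrow> 'f tm" where
  "subst_tm s (Var i) = s i"
| "subst_tm s (Fun f ts) = Fun f (map (subst_tm s) ts)"

definition lift_subst :: "(nat \<Rightarrow> 'f tm) \<Rightarrow> nat \<Rightarrow> 'f tm" where
  "lift_subst s = case_nat (Var 0) (\<lambda>i. subst_tm (\<lambda>j. Var (Suc j)) (s i))"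

primrec subst_fm :: "(nat \<Rightarrow> 'f tm) \<Rightarrow> ('f, 'r) fm \<Rightarrow> ('f, 'r) fm" where
  "subst_fm s (Rel r ts) = Rel r (map (subst_tm s) ts)"
| "subst_fm s Bot = Bot"
| "subst_fm s (Imp A B) = Imp (subst_fm s A) (subst_fm s B)"
| "subst_fm s (Exists A) = Exists (subst_fm (lift_subst s) A)"

text \<open>If \<open>Exists A\<close> renders \<open>(\<exists>x)A\<close>, then \<open>inst t A\<close> renders \<open>A[t/x]\<close>.\<close>

definition inst :: "'f tm \<Rightarrow> ('f, 'r) fm \<Rightarrow> ('f, 'r) fm" where
  "inst t A = subst_fm (case_nat t Var) A"

record ('f, 'r, 'm) struct =
  universe :: "'m set"
  fun_int :: "'f \<Rightarrow> 'm list \<Rightarrow> 'm"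
  rel_int :: "'r \<Rightarrow> 'm list \<Rightarrow> real"

definition unit_structure :: "('f, 'r) signature \<Rightarrow> ('f, 'r, 'm) struct \<Rightarrow> bool" where
  "unit_structure L M \<longleftrightarrow>
     universe M \<noteq> {} \<and>
     (\<forall>f \<in> funs L. \<forall>ms. length ms = fun_arity L f \<and> set ms \<subseteq> universe M
        \<longrightarrow> fun_int M f ms \<in> universe M) \<and>
     (\<forall>r \<in> rels L. \<forall>ms. length ms = rel_arity L r \<and> set ms \<subseteq> universe M
        \<longrightarrow> rel_int M r ms \<in> {0..1})"

text \<open>Parameters from the structure enter through an assignment \<open>e\<close> of its elements to the
  free variables.\<close>

primrec tm_val :: "('f, 'r, 'm) struct \<Rightarrow> (nat \<Rightarrow> 'm) \<Rightarrow> 'f tm \<Rightarrow> 'm" where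
  "tm_val M e (Var i) = e i"
| "tm_val M e (Fun f ts) = fun_int M f (map (tm_val M e) ts)"

primrec fm_val :: "('f, 'r, 'm) struct \<Rightarrow> (nat \<Rightarrow> 'm) \<Rightarrow> ('f, 'r) fm \<Rightarrow> real" where
  "fm_val M e (Rel r ts) = rel_int M r (map (tm_val M e) ts)"
| "fm_val M e Bot = 1"
| "fm_val M e (Imp A B) = max (fm_val M e B - fm_val M e A) 0"
| "fm_val M e (Exists A) = (INF m \<in> universe M. fm_val M (case_nat m e) A)"

definition seq_val :: "('f, 'r, 'm) struct \<Rightarrow> (nat \<Rightarrow> 'm) \<Rightarrow> ('f, 'r) sequent \<Rightarrow> real" where
  "seq_val M e S = (\<Sum>A \<in># snd S. fm_val M e A) - (\<Sum>B \<in># fst S. fm_val M e B)"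

definition hyp_val :: "('f, 'r, 'm) struct \<Rightarrow> (nat \<Rightarrow> 'm) \<Rightarrow> ('f, 'r) hypersequent \<Rightarrow> real" where
  "hyp_val M e H = Min (seq_val M e ` set_mset H)"

text \<open>The type argument is the type from which the universes of the structures are drawn.
  The assignment \<open>e\<close> is immaterial when \<open>H\<close> has no free variables.
  The empty hypersequent has no minimum (conventionally \<open>\<infinity>\<close>) and counts as not valid.\<close>

definition valid :: "'m itself \<Rightarrow> ('f, 'r) signature \<Rightarrow> ('f, 'r) hypersequent \<Rightarrow> bool" where
  "valid (ty :: 'm itself) L H \<longleftrightarrow>
     H \<noteq> {#} \<and>
     (\<forall>(M :: ('f, 'r, 'm) struct) e.
        unit_structure L M \<and> range e \<subseteq> universe M \<longrightarrow> hyp_val M e H \<le> 0)"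

definition approx_seq :: "nat \<Rightarrow> ('f, 'r) sequent \<Rightarrow> ('f, 'r) sequent" where
  "approx_seq n S = (add_mset Bot (repeat_mset n (fst S)), repeat_mset n (snd S))"

definition approx_hyp :: "nat \<Rightarrow> ('f, 'r) hypersequent \<Rightarrow> ('f, 'r) hypersequent" where
  "approx_hyp n H = image_mset (approx_seq n) H"

text \<open>The well-formedness premises confine derivations to the language of \<open>L\<close>; where none is
  stated, well-formedness of the conclusion is inherited from the rule premises.\<close>

inductive derivable :: "('f, 'r) signature \<Rightarrow> ('f, 'r) hypersequent \<Rightarrow> bool"
  for L :: "('f, 'r) signature" where
  init_id: "wf_fm L A \<Longrightarrow> derivable L {#({#A#}, {#A#})#}"
| init_empty: "derivable L {#({#}, {#})#}"
| init_bot: "wf_fm L A \<Longrightarrow> derivable L {#({#Bot#}, {#A#})#}"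
| ec: "derivable L (G + {#(\<Gamma>, \<Delta>), (\<Gamma>, \<Delta>)#}) \<Longrightarrow> derivable L (G + {#(\<Gamma>, \<Delta>)#})"
| ew: "derivable L (G + {#(\<Gamma>, \<Delta>)#}) \<Longrightarrow> wf_seq L (\<Gamma>', \<Delta>')
    \<Longrightarrow> derivable L (G + {#(\<Gamma>, \<Delta>), (\<Gamma>', \<Delta>')#})"
| split: "derivable L (G + {#(\<Gamma>\<^sub>0 + \<Gamma>\<^sub>1, \<Delta>\<^sub>0 + \<Delta>\<^sub>1)#})
    \<Longrightarrow> derivable L (G + {#(\<Gamma>\<^sub>0, \<Delta>\<^sub>0), (\<Gamma>\<^sub>1, \<Delta>\<^sub>1)#})"
| mix: "derivable L (G + {#(\<Gamma>\<^sub>0, \<Delta>\<^sub>0)#}) \<Longrightarrow> derivable L (G + {#(\<Gamma>\<^sub>1, \<Delta>\<^sub>1)#})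
    \<Longrightarrow> derivable L (G + {#(\<Gamma>\<^sub>0 + \<Gamma>\<^sub>1, \<Delta>\<^sub>0 + \<Delta>\<^sub>1)#})"
| wl: "derivable L (G + {#(\<Gamma>, \<Delta>)#}) \<Longrightarrow> wf_fm L A
    \<Longrightarrow> derivable L (G + {#(add_mset A \<Gamma>, \<Delta>)#})"
| imp_left: "derivable L (G + {#(add_mset B \<Gamma>, add_mset A \<Delta>), (\<Gamma>, \<Delta>)#})
    \<Longrightarrow> derivable L (G + {#(add_mset (Imp A B) \<Gamma>, \<Delta>)#})"
| imp_right: "derivable L (G + {#(add_mset A \<Gamma>, add_mset B \<Delta>)#})
    \<Longrightarrow> derivable L (G + {#(\<Gamma>, \<Delta>)#})
    \<Longrightarrow> derivable L (G + {#(\<Gamma>, add_mset (Imp A B) \<Delta>)#})"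
| ex_left: "derivable L (G + {#(add_mset (inst (Var c) A) \<Gamma>, \<Delta>)#})
    \<Longrightarrow> c \<notin> fv_hyp (G + {#(add_mset (Exists A) \<Gamma>, \<Delta>)#})
    \<Longrightarrow> derivable L (G + {#(add_mset (Exists A) \<Gamma>, \<Delta>)#})"
| ex_right: "derivable L (G + {#(\<Gamma>, add_mset (inst t A) \<Delta>)#}) \<Longrightarrow> wf_tm L t
    \<Longrightarrow> derivable L (G + {#(\<Gamma>, add_mset (Exists A) \<Delta>)#})"

end

theory Submission
  imports Defs "HOL-Library.Countable_Set"
begin

text \<open>If \<open>H\<^sub>1\<^sub>/\<^sub>n\<close> is underivable, a Henkin construction extends it to a maximal set \<open>T\<close> of sequents
  none of whose finite subsets is a derivable hypersequent. Maximality makes \<open>T\<close> closed under the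
  inverted logical rules and, because of (split), under addition of sequents. Read as a linear
  inequality over the truth values of atoms, each atomic sequent of \<open>T\<close> is satisfiable in the unit
  cube, since otherwise it would follow from (id), \<open>\<bottom> \<Rightarrow> A\<close>, (mix) and (wl). Closure under addition
  then allows the truth values to be chosen one atom at a time, as in Fourier-Motzkin elimination,
  so that all these inequalities hold at once. In the resulting term model every sequent of \<open>T\<close> has
  value at least 0, by induction on the number of connectives. Hence every component of \<open>H\<close> has
  value at least \<open>1/n\<close> and \<open>H\<close> is not valid.\<close>

section \<open>Structural rules\<close>

lemma wf_hyp_simps [simp]:
  "wf_hyp L {#}"
  "wf_hyp L (add_mset S G) \<longleftrightarrow> wf_seq L S \<and> wf_hyp L G"
  "wf_hyp L (G + G') \<longleftrightarrow> wf_hyp L G \<and> wf_hyp L G'"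
  by (auto simp: wf_hyp_def)

lemma wf_seq_Pair [simp]:
  "wf_seq L (\<Gamma>, \<Delta>) \<longleftrightarrow> (\<forall>A \<in># \<Gamma>. wf_fm L A) \<and> (\<forall>A \<in># \<Delta>. wf_fm L A)"
  by (auto simp: wf_seq_def)

lemma not_derivable_empty: "\<not> derivable L {#}"
proof -
  have "derivable L G \<Longrightarrow> G \<noteq> {#}" for G
    by (induction rule: derivable.induct) auto
  then show ?thesis by blast
qed

lemma derivable_weaken:
  assumes "derivable L G" "wf_hyp L G'"
  shows "derivable L (G + G')"
  using assms(2)
proof (induction G')
  case empty
  then show ?case using assms(1) by simp
next
  case (add S G')
  then have der: "derivable L (G + G')" by simp
  then obtain S' K where K: "G + G' = add_mset S' K"
    by (metis not_derivable_empty multiset_cases)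
  show ?case
    using ew[of L K "fst S'" "snd S'" "fst S" "snd S"] der add.prems
    by (simp add: K add_mset_commute)
qed

text \<open>(ew) adds all of \<open>G'\<close> and (ec) then absorbs the copies coming from
  \<open>G\<close>. Multiplicities of components are thus immaterial, which allows hypersequents to
  be drawn from a set of sequents.\<close>

lemma derivable_mono:
  assumes "derivable L G" "set_mset G \<subseteq> set_mset G'" "wf_hyp L G'"
  shows "derivable L G'"
proof -
  have contract: "derivable L (K + G') \<Longrightarrow> set_mset K \<subseteq> set_mset G' \<Longrightarrow> derivable L G'" for K
  proof (induction K)
    case empty
    then show ?case by simp
  next
    case (add S K)
    then obtain G'' where "G' = add_mset S G''"
      by (metis insert_DiffM insert_subset set_mset_add_mset_insert)
    then show ?case
      using add ec[of L "K + G''" "fst S" "snd S"] by simp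
  qed
  show ?thesis
    using contract[OF derivable_weaken[OF assms(1,3)] assms(2)] .
qed

lemma derivable_wl_mset:
  assumes "derivable L {#(\<Gamma>, \<Delta>)#}" "\<forall>A \<in># \<Gamma>'. wf_fm L A"
  shows "derivable L {#(\<Gamma> + \<Gamma>', \<Delta>)#}"
  using assms(2)
proof (induction \<Gamma>')
  case (add A \<Gamma>')
  then show ?case using wl[of L "{#}" "\<Gamma> + \<Gamma>'" \<Delta> A] by simp
qed (use assms in simp)

lemma derivable_id_mset:
  "\<forall>A \<in># \<Gamma>. wf_fm L A \<Longrightarrow> derivable L {#(\<Gamma>, \<Gamma>)#}"
proof (induction \<Gamma>)
  case (add A \<Gamma>)
  then show ?case
    using mix[of L "{#}" "{#A#}" "{#A#}" \<Gamma> \<Gamma>] by (simp add: init_id)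
qed (simp add: init_empty)

lemma derivable_bot_mset:
  "\<forall>A \<in># \<Delta>. wf_fm L A \<Longrightarrow> derivable L {#(replicate_mset (size \<Delta>) Bot, \<Delta>)#}"
proof (induction \<Delta>)
  case (add A \<Delta>)
  then show ?case
    using mix[of L "{#}" "{#Bot#}" "{#A#}" "replicate_mset (size \<Delta>) Bot" \<Delta>]
    by (simp add: init_bot)
qed (simp add: init_empty)

text \<open>The common part comes from (id), each remaining formula of \<Delta> is paid for by one
  \<open>Bot\<close>, (mix) joins the two, and (wl) adds what is left of \<Gamma>.\<close>

lemma derivable_if_enough_bot:
  assumes wf: "wf_seq L (\<Gamma>, \<Delta>)" and le: "size (\<Delta> - \<Gamma>) \<le> count (\<Gamma> - \<Delta>) Bot"
  shows "derivable L {#(\<Gamma>, \<Delta>)#}"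
proof -
  let ?Z = "\<Gamma> \<inter># \<Delta>" and ?B = "replicate_mset (size (\<Delta> - \<Gamma>)) Bot"
  have split_inter: "M = M \<inter># N + (M - N)" for M N :: "('a, 'b) fm multiset"
    by (intro multiset_eqI) auto
  have sub: "?B \<subseteq># \<Gamma> - \<Delta>"
    using le by (simp only: count_le_replicate_mset_subset_eq)
  have \<Gamma>: "\<Gamma> = ?Z + ?B + (\<Gamma> - \<Delta> - ?B)"
    using subset_mset.add_diff_inverse[OF sub] split_inter[of \<Gamma> \<Delta>] by (metis add.assoc)
  have \<Delta>: "\<Delta> = ?Z + (\<Delta> - \<Gamma>)"
    using split_inter[of \<Delta> \<Gamma>] by (simp add: subset_mset.inf_commute)
  have "derivable L {#(?Z, ?Z)#}" "derivable L {#(?B, \<Delta> - \<Gamma>)#}"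
    using wf by (auto intro!: derivable_id_mset derivable_bot_mset dest: in_diffD)
  then have "derivable L {#(?Z + ?B, ?Z + (\<Delta> - \<Gamma>))#}"
    using mix[of L "{#}"] by simp
  then have "derivable L {#(?Z + ?B + (\<Gamma> - \<Delta> - ?B), ?Z + (\<Delta> - \<Gamma>))#}"
    by (rule derivable_wl_mset) (use wf in \<open>auto dest: in_diffD\<close>)
  then show ?thesis using \<Gamma> \<Delta> by simp
qed

section \<open>Simultaneous satisfiability of integral linear inequalities over the unit cube\<close>

text \<open>The pair \<open>(\<Gamma>, \<Delta>)\<close> stands for the linear form \<open>\<Sum>\<Delta> - \<Sum>\<Gamma>\<close>. The coordinates
  in \<open>J\<close> are fixed by \<open>v\<close>, the others range over \<open>[0,1]\<close>, and the maximum is taken.\<close>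

definition partial_max ::
    "('a \<Rightarrow> real) \<Rightarrow> 'a set \<Rightarrow> 'a multiset \<Rightarrow> 'a multiset \<Rightarrow> real" where
  "partial_max v J \<Gamma> \<Delta> =
     (\<Sum>a \<in># filter_mset (\<lambda>a. a \<in> J) \<Delta>. v a) - (\<Sum>a \<in># filter_mset (\<lambda>a. a \<in> J) \<Gamma>. v a)
     + real (size (filter_mset (\<lambda>a. a \<notin> J) \<Delta> - filter_mset (\<lambda>a. a \<notin> J) \<Gamma>))"

lemma size_diff_add_le:
  fixes A B C D :: "'a multiset"
  shows "size ((A + B) - (C + D)) \<le> size (A - C) + size (B - D)"
proof -
  have "(A + B) - (C + D) \<subseteq># (A - C) + (B - D)"
    by (auto simp: subseteq_mset_def)
  then show ?thesis
    using size_mset_mono by fastforce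
qed

text \<open>The maximum of a sum is at most the sum of the maxima; on the free coordinates this is
  subadditivity of truncated multiset difference.\<close>

lemma partial_max_add:
  "partial_max v J (\<Gamma> + \<Gamma>') (\<Delta> + \<Delta>') \<le> partial_max v J \<Gamma> \<Delta> + partial_max v J \<Gamma>' \<Delta>'"
  using size_diff_add_le[of "filter_mset (\<lambda>a. a \<notin> J) \<Delta>" "filter_mset (\<lambda>a. a \<notin> J) \<Delta>'"
      "filter_mset (\<lambda>a. a \<notin> J) \<Gamma>" "filter_mset (\<lambda>a. a \<notin> J) \<Gamma>'"]
  unfolding partial_max_def filter_union_mset image_mset_union sum_mset.union by linarith

lemma partial_max_repeat:
  "partial_max v J (repeat_mset n \<Gamma>) (repeat_mset n \<Delta>) \<le> real n * partial_max v J \<Gamma> \<Delta>"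
proof (induction n)
  case 0
  then show ?case by (simp add: partial_max_def)
next
  case (Suc n)
  then show ?case
    using partial_max_add[of v J \<Gamma> "repeat_mset n \<Gamma>" \<Delta> "repeat_mset n \<Delta>"]
    by (simp add: algebra_simps)
qed

text \<open>\<open>d\<close> is the coefficient of \<open>a\<close> and \<open>R\<close> the
  contribution of the other coordinates. A free \<open>a\<close> takes its best value in [0,1],
  which is 1 if \<open>d > 0\<close> and 0 if \<open>d < 0\<close>.\<close>

lemma partial_max_insert:
  fixes v :: "'a \<Rightarrow> real" and \<Gamma> \<Delta> :: "'a multiset"
  assumes "a \<notin> J"
  defines "d \<equiv> real (count \<Delta> a) - real (count \<Gamma> a)"
    and "R \<equiv> partial_max v J (filter_mset (\<lambda>b. b \<noteq> a) \<Gamma>) (filter_mset (\<lambda>b. b \<noteq> a) \<Delta>)"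
  shows "partial_max v J \<Gamma> \<Delta> = R + max d 0"
    and "partial_max (v(a := c)) (insert a J) \<Gamma> \<Delta> = R + c * d"
proof -
  have J: "filter_mset (\<lambda>b. b \<in> J) M = filter_mset (\<lambda>b. b \<in> J) (filter_mset (\<lambda>b. b \<noteq> a) M)" for M
    using assms(1) by (auto simp: filter_filter_mset intro!: filter_mset_cong)
  have nJ: "filter_mset (\<lambda>b. b \<notin> J) M =
      filter_mset (\<lambda>b. b \<notin> J) (filter_mset (\<lambda>b. b \<noteq> a) M) + replicate_mset (count M a) a" for M
    using assms(1) by (intro multiset_eqI) auto
  have iJ: "filter_mset (\<lambda>b. b \<in> insert a J) M =
      filter_mset (\<lambda>b. b \<in> J) (filter_mset (\<lambda>b. b \<noteq> a) M) + replicate_mset (count M a) a" for M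
    using assms(1) by (intro multiset_eqI) auto
  have niJ: "filter_mset (\<lambda>b. b \<notin> insert a J) M =
      filter_mset (\<lambda>b. b \<notin> J) (filter_mset (\<lambda>b. b \<noteq> a) M)" for M
    by (intro multiset_eqI) auto
  have diff: "filter_mset (\<lambda>b. b \<notin> J) \<Delta> - filter_mset (\<lambda>b. b \<notin> J) \<Gamma> =
      (filter_mset (\<lambda>b. b \<notin> J) (filter_mset (\<lambda>b. b \<noteq> a) \<Delta>)
        - filter_mset (\<lambda>b. b \<notin> J) (filter_mset (\<lambda>b. b \<noteq> a) \<Gamma>))
      + replicate_mset (count \<Delta> a - count \<Gamma> a) a"
    using assms(1) by (intro multiset_eqI) auto
  show "partial_max v J \<Gamma> \<Delta> = R + max d 0"
    unfolding partial_max_def R_def d_def diff J[of \<Gamma>] J[of \<Delta>]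
    by (simp add: max_def of_nat_diff)
  have upd: "(\<Sum>b \<in># filter_mset (\<lambda>b. b \<in> J) (filter_mset (\<lambda>b. b \<noteq> a) M). (v(a := c)) b) =
      (\<Sum>b \<in># filter_mset (\<lambda>b. b \<in> J) (filter_mset (\<lambda>b. b \<noteq> a) M). v b)" for M
    by (rule arg_cong[where f = sum_mset]) (auto intro: image_mset_cong)
  show "partial_max (v(a := c)) (insert a J) \<Gamma> \<Delta> = R + c * d"
    unfolding partial_max_def R_def d_def iJ niJ
    by (simp only: image_mset_union sum_mset.union upd) (simp add: algebra_simps)
qed

lemma between_real_sets:
  fixes A B :: "real set"
  assumes "A \<noteq> {}" "B \<noteq> {}" "\<And>a b. a \<in> A \<Longrightarrow> b \<in> B \<Longrightarrow> a \<le> b"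
  obtains c where "\<And>a. a \<in> A \<Longrightarrow> a \<le> c" "\<And>b. b \<in> B \<Longrightarrow> c \<le> b"
proof
  have "bdd_above A" using assms by (meson bdd_above.I ex_in_conv)
  then show "a \<le> Sup A" if "a \<in> A" for a using that by (simp add: cSup_upper)
  show "Sup A \<le> b" if "b \<in> B" for b using that assms by (simp add: cSup_least)
qed

text \<open>One elimination step. A form with \<open>d > 0\<close> bounds \<open>c\<close> below by
  \<open>- R / d\<close>, one with \<open>d < 0\<close> bounds it above by \<open>R / - d\<close>.
  Such bounds never conflict, since a positive combination of the two forms in which
  \<open>a\<close> cancels is again in \<open>K\<close>.\<close>

lemma partial_max_extend:
  fixes K :: "('a multiset \<times> 'a multiset) set" and v :: "'a \<Rightarrow> real"
  assumes add: "\<And>\<Gamma> \<Delta> \<Gamma>' \<Delta>'. (\<Gamma>, \<Delta>) \<in> K \<Longrightarrow> (\<Gamma>', \<Delta>') \<in> K \<Longrightarrow> (\<Gamma> + \<Gamma>', \<Delta> + \<Delta>') \<in> K"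
    and nonneg: "\<And>\<Gamma> \<Delta>. (\<Gamma>, \<Delta>) \<in> K \<Longrightarrow> 0 \<le> partial_max v J \<Gamma> \<Delta>"
    and "a \<notin> J"
  shows "\<exists>c \<in> {0..1}. \<forall>(\<Gamma>, \<Delta>) \<in> K. 0 \<le> partial_max (v(a := c)) (insert a J) \<Gamma> \<Delta>"
proof -
  define d :: "'a multiset \<Rightarrow> 'a multiset \<Rightarrow> real"
    where "d \<Gamma> \<Delta> = real (count \<Delta> a) - real (count \<Gamma> a)" for \<Gamma> \<Delta>
  define R where
    "R \<Gamma> \<Delta> = partial_max v J (filter_mset (\<lambda>b. b \<noteq> a) \<Gamma>) (filter_mset (\<lambda>b. b \<noteq> a) \<Delta>)"
    for \<Gamma> \<Delta>
  have ins: "partial_max v J \<Gamma> \<Delta> = R \<Gamma> \<Delta> + max (d \<Gamma> \<Delta>) 0"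
    "partial_max (v(a := c)) (insert a J) \<Gamma> \<Delta> = R \<Gamma> \<Delta> + c * d \<Gamma> \<Delta>" for \<Gamma> \<Delta> c
    unfolding R_def d_def by (rule partial_max_insert[OF \<open>a \<notin> J\<close>])+
  have R_max: "0 \<le> R \<Gamma> \<Delta> + max (d \<Gamma> \<Delta>) 0" if "(\<Gamma>, \<Delta>) \<in> K" for \<Gamma> \<Delta>
    using nonneg[OF that] ins(1) by simp
  \<comment> \<open>Only positive multiples, hence \<open>Suc n\<close>: the pair of empty multisets
    need not lie in \<open>K\<close>.\<close>
  have repeat: "(repeat_mset (Suc n) \<Gamma>, repeat_mset (Suc n) \<Delta>) \<in> K" if "(\<Gamma>, \<Delta>) \<in> K" for n \<Gamma> \<Delta>
  proof (induction n)
    case (Suc n)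
    then show ?case using add[OF that Suc] by simp
  qed (use that in simp)
  have filter_repeat: "filter_mset Q (repeat_mset n M) = repeat_mset n (filter_mset Q M)"
    for Q n and M :: "'a multiset"
    by (intro multiset_eqI) auto
  have cross: "- R \<Gamma> \<Delta> / d \<Gamma> \<Delta> \<le> R \<Gamma>' \<Delta>' / - d \<Gamma>' \<Delta>'"
    if K: "(\<Gamma>, \<Delta>) \<in> K" "(\<Gamma>', \<Delta>') \<in> K" and pos: "d \<Gamma> \<Delta> > 0" and neg: "d \<Gamma>' \<Delta>' < 0"
    for \<Gamma> \<Delta> \<Gamma>' \<Delta>'
  proof -
    \<comment> \<open>Each form is weighted with the absolute coefficient of \<open>a\<close> in the
      other, so that \<open>a\<close> cancels in the combination.\<close>
    define m where "m = count \<Delta> a - count \<Gamma> a"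
    define n where "n = count \<Gamma>' a - count \<Delta>' a"
    have m: "real m = d \<Gamma> \<Delta>" and n: "real n = - d \<Gamma>' \<Delta>'"
      using pos neg by (auto simp: d_def m_def n_def)
    have "m > 0" "n > 0" using m n pos neg by auto
    then have "(repeat_mset n \<Gamma> + repeat_mset m \<Gamma>', repeat_mset n \<Delta> + repeat_mset m \<Delta>') \<in> K"
      using add[OF repeat[OF K(1), of "n - 1"] repeat[OF K(2), of "m - 1"]] by simp
    moreover have "d (repeat_mset n \<Gamma> + repeat_mset m \<Gamma>') (repeat_mset n \<Delta> + repeat_mset m \<Delta>')
        = real n * d \<Gamma> \<Delta> + real m * d \<Gamma>' \<Delta>'"
      by (simp add: d_def algebra_simps)
    then have "d (repeat_mset n \<Gamma> + repeat_mset m \<Gamma>') (repeat_mset n \<Delta> + repeat_mset m \<Delta>') = 0"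
      by (simp add: m n)
    ultimately have "0 \<le> R (repeat_mset n \<Gamma> + repeat_mset m \<Gamma>') (repeat_mset n \<Delta> + repeat_mset m \<Delta>')"
      using R_max by fastforce
    also have "\<dots> \<le> R (repeat_mset n \<Gamma>) (repeat_mset n \<Delta>) + R (repeat_mset m \<Gamma>') (repeat_mset m \<Delta>')"
      unfolding R_def filter_union_mset by (rule partial_max_add)
    also have "\<dots> \<le> real n * R \<Gamma> \<Delta> + real m * R \<Gamma>' \<Delta>'"
      unfolding R_def filter_repeat by (intro add_mono partial_max_repeat)
    finally show ?thesis
      using pos neg by (simp add: m n field_simps)
  qed
  \<comment> \<open>The elements 0 and 1 force \<open>c\<close> into the unit interval and keep both
    sets nonempty, as the separation requires.\<close>
  define Lo where "Lo = insert 0 {- R \<Gamma> \<Delta> / d \<Gamma> \<Delta> | \<Gamma> \<Delta>. (\<Gamma>, \<Delta>) \<in> K \<and> d \<Gamma> \<Delta> > 0}"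
  define Up where "Up = insert 1 {R \<Gamma> \<Delta> / - d \<Gamma> \<Delta> | \<Gamma> \<Delta>. (\<Gamma>, \<Delta>) \<in> K \<and> d \<Gamma> \<Delta> < 0}"
  have "l \<le> u" if "l \<in> Lo" "u \<in> Up" for l u
  proof -
    have "- R \<Gamma> \<Delta> / d \<Gamma> \<Delta> \<le> 1" if "(\<Gamma>, \<Delta>) \<in> K" "d \<Gamma> \<Delta> > 0" for \<Gamma> \<Delta>
      using R_max[OF that(1)] that(2) by (simp add: field_simps)
    moreover have "0 \<le> R \<Gamma> \<Delta> / - d \<Gamma> \<Delta>" if "(\<Gamma>, \<Delta>) \<in> K" "d \<Gamma> \<Delta> < 0" for \<Gamma> \<Delta>
      using R_max[OF that(1)] that(2) by (intro divide_nonneg_pos) auto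
    ultimately show ?thesis
      using that cross unfolding Lo_def Up_def by fastforce
  qed
  then obtain c where c: "\<And>l. l \<in> Lo \<Longrightarrow> l \<le> c" "\<And>u. u \<in> Up \<Longrightarrow> c \<le> u"
    using between_real_sets[of Lo Up] by (auto simp: Lo_def Up_def)
  have "0 \<le> R \<Gamma> \<Delta> + c * d \<Gamma> \<Delta>" if K: "(\<Gamma>, \<Delta>) \<in> K" for \<Gamma> \<Delta>
  proof (cases "d \<Gamma> \<Delta>" "0 :: real" rule: linorder_cases)
    case less
    then have "c \<le> R \<Gamma> \<Delta> / - d \<Gamma> \<Delta>" using c(2) K by (auto simp: Up_def)
    then show ?thesis using less by (simp add: field_simps)
  next
    case equal
    then show ?thesis using R_max[OF K] by simp
  next
    case greater
    then have "- R \<Gamma> \<Delta> / d \<Gamma> \<Delta> \<le> c" using c(1) K by (auto simp: Lo_def)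
    then show ?thesis using greater by (simp add: field_simps)
  qed
  moreover have "c \<in> {0..1}" using c by (auto simp: Lo_def Up_def)
  ultimately show ?thesis using ins(2) by (intro bexI[of _ c]) auto
qed

text \<open>Coordinates are fixed along an enumeration while all partial maxima stay nonnegative. A
  pair involves only finitely many coordinates, so at some stage all of them are fixed and its
  partial maximum is the actual value of the form. The coordinate \<open>u\<close> will later be
  \<open>Bot\<close>.\<close>

lemma additive_forms_satisfiable:
  fixes K :: "('a multiset \<times> 'a multiset) set"
  assumes "countable U"
    and supp: "\<And>\<Gamma> \<Delta>. (\<Gamma>, \<Delta>) \<in> K \<Longrightarrow> set_mset (\<Gamma> + \<Delta>) \<subseteq> U"
    and add: "\<And>\<Gamma> \<Delta> \<Gamma>' \<Delta>'. (\<Gamma>, \<Delta>) \<in> K \<Longrightarrow> (\<Gamma>', \<Delta>') \<in> K \<Longrightarrow> (\<Gamma> + \<Gamma>', \<Delta> + \<Delta>') \<in> K"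
    and sat: "\<And>\<Gamma> \<Delta>. (\<Gamma>, \<Delta>) \<in> K \<Longrightarrow> 0 \<le> partial_max (\<lambda>_. 1) {u} \<Gamma> \<Delta>"
  obtains v :: "'a \<Rightarrow> real" where "v u = 1" "\<And>a. v a \<in> {0..1}"
    "\<And>\<Gamma> \<Delta>. (\<Gamma>, \<Delta>) \<in> K \<Longrightarrow> (\<Sum>a \<in># \<Gamma>. v a) \<le> (\<Sum>a \<in># \<Delta>. v a)"
proof -
  \<comment> \<open>Inserting \<open>u\<close> makes the enumerated set nonempty, so it is the range
    of \<open>s\<close>, possibly with repetitions.\<close>
  define s where "s = from_nat_into (insert u U)"
  define J where "J k = insert u (s ` {..<k})" for k :: nat
  define P where "P k w \<longleftrightarrow> w u = 1 \<and> (\<forall>a. w a \<in> {0..1}) \<and>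
    (\<forall>(\<Gamma>, \<Delta>) \<in> K. 0 \<le> partial_max w (J k) \<Gamma> \<Delta>)" for k and w :: "'a \<Rightarrow> real"
  have "\<exists>f. \<forall>k. P k (f k) \<and> (\<forall>a \<in> J k. f (Suc k) a = f k a)"
  proof (rule dependent_nat_choice)
    show "\<exists>w. P 0 w"
      using sat by (intro exI[of _ "\<lambda>_. 1"]) (auto simp: P_def J_def)
  next
    fix w k assume w: "P k w"
    have J_Suc: "J (Suc k) = insert (s k) (J k)" by (auto simp: J_def lessThan_Suc)
    show "\<exists>w'. P (Suc k) w' \<and> (\<forall>a \<in> J k. w' a = w a)"
    proof (cases "s k \<in> J k")
      case True
      then show ?thesis using w by (auto simp: P_def J_Suc insert_absorb)
    next
      case False
      have "0 \<le> partial_max w (J k) \<Gamma> \<Delta>" if "(\<Gamma>, \<Delta>) \<in> K" for \<Gamma> \<Delta>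
        using w that by (auto simp: P_def)
      from partial_max_extend[OF add this False]
      obtain c where c: "c \<in> {0..1}"
        "\<forall>(\<Gamma>, \<Delta>) \<in> K. 0 \<le> partial_max (w(s k := c)) (insert (s k) (J k)) \<Gamma> \<Delta>"
        by blast
      have "s k \<noteq> u" using False by (auto simp: J_def)
      then show ?thesis
        using c w False by (intro exI[of _ "w(s k := c)"]) (auto simp: P_def J_Suc)
    qed
  qed
  then obtain f where f: "\<And>k. P k (f k)" "\<And>k a. a \<in> J k \<Longrightarrow> f (Suc k) a = f k a" by blast
  have J_mono: "J k \<subseteq> J l" if "k \<le> l" for k l using that by (auto simp: J_def)
  have stable: "f l a = f k a" if "k \<le> l" "a \<in> J k" for k l a
    using that(1)
  proof (induction l rule: dec_induct)
    case (step l)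
    then show ?case using f(2)[of a l] J_mono[of k l] that(2) by auto
  qed simp
  have cover: "\<exists>k. a \<in> J k" if a: "a \<in> insert u U" for a
  proof -
    obtain i where "a = s i"
      using from_nat_into_surj[OF countable_insert[OF assms(1)] a] unfolding s_def by metis
    then have "a \<in> J (Suc i)" by (simp add: J_def)
    then show ?thesis ..
  qed
  \<comment> \<open>For an \<open>a\<close> outside the enumeration the stage is unspecified, but
    every \<open>f k\<close> takes values in [0,1] anyway.\<close>
  define v where "v a = f (LEAST k. a \<in> J k) a" for a
  have v_eq: "v a = f k a" if "a \<in> J k" for a k
    unfolding v_def
    using stable[OF Least_le[of "\<lambda>k. a \<in> J k", OF that] LeastI[of "\<lambda>k. a \<in> J k", OF that]] by simp
  show thesis
  proof
    show "v u = 1" "v a \<in> {0..1}" for a using f(1) by (auto simp: v_def P_def)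
    fix \<Gamma> \<Delta> assume K: "(\<Gamma>, \<Delta>) \<in> K"
    have "\<exists>k. set_mset M \<subseteq> J k" if "set_mset M \<subseteq> U" for M
      using that
    proof (induction M)
      case (add a M)
      then obtain k where "set_mset M \<subseteq> J k" by auto
      moreover obtain l where "a \<in> J l" using cover[of a] add.prems by auto
      ultimately have "set_mset (add_mset a M) \<subseteq> J (max k l)"
        using J_mono[of k "max k l"] J_mono[of l "max k l"] by auto
      then show ?case by blast
    qed simp
    then obtain k where k: "set_mset (\<Gamma> + \<Delta>) \<subseteq> J k" using supp[OF K] by blast
    have "filter_mset (\<lambda>a. a \<in> J k) M = M" "filter_mset (\<lambda>a. a \<notin> J k) M = {#}"
      "image_mset (f k) M = image_mset v M" if "set_mset M \<subseteq> J k" for M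
      using that v_eq by (auto simp: filter_mset_eq_conv subset_iff intro!: image_mset_cong)
    then have eqs: "filter_mset (\<lambda>a. a \<in> J k) \<Gamma> = \<Gamma>" "filter_mset (\<lambda>a. a \<in> J k) \<Delta> = \<Delta>"
      "filter_mset (\<lambda>a. a \<notin> J k) \<Delta> = {#}"
      "image_mset (f k) \<Gamma> = image_mset v \<Gamma>" "image_mset (f k) \<Delta> = image_mset v \<Delta>"
      using k by auto
    have "0 \<le> partial_max (f k) (J k) \<Gamma> \<Delta>"
      using f(1)[of k] K by (auto simp: P_def)
    then show "(\<Sum>a \<in># \<Gamma>. v a) \<le> (\<Sum>a \<in># \<Delta>. v a)"
      unfolding partial_max_def eqs by simp
  qed
qed

section \<open>Countability of the language\<close>

instance tm :: (countable) countable
  by countable_datatype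

instance fm :: (countable, countable) countable
  by countable_datatype

lemma set_tm_wf: "wf_tm L t \<Longrightarrow> set_tm t \<subseteq> funs L"
  by (induction t) (auto simp: list_all_iff)

lemma set_fm_wf: "wf_fm L A \<Longrightarrow> set1_fm A \<subseteq> funs L \<and> set2_fm A \<subseteq> rels L"
  by (induction A) (auto simp: list_all_iff dest: set_tm_wf)

text \<open>The type of symbols may be uncountable, but only symbols of \<open>funs L\<close> occur;
  numbering these embeds the terms into the countable type \<open>nat tm\<close>.\<close>

lemma countable_wf_tm:
  assumes "countable (funs L)"
  shows "countable {t. wf_tm L t}"
proof (rule countableI')
  show "inj_on (to_nat \<circ> map_tm (to_nat_on (funs L))) {t. wf_tm L t}"
    using assms by (auto intro!: inj_onI elim!: tm.inj_map_strong[rotated]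
        dest!: set_tm_wf simp: subset_iff)
qed

lemma countable_wf_fm:
  assumes "countable (funs L)" "countable (rels L)"
  shows "countable {A. wf_fm L A}"
proof (rule countableI')
  show "inj_on (to_nat \<circ> map_fm (to_nat_on (funs L)) (to_nat_on (rels L))) {A. wf_fm L A}"
    using assms by (auto intro!: inj_onI elim!: fm.inj_map_strong[rotated 2]
        dest!: set_fm_wf simp: subset_iff)
qed

lemma countable_wf_seq:
  assumes "countable (funs L)" "countable (rels L)"
  shows "countable {S. wf_seq L S}"
proof -
  let ?W = "mset ` lists {A. wf_fm L A}"
  have "M \<in> ?W" if "\<forall>A \<in># M. wf_fm L A" for M
    using that by (metis ex_mset image_eqI in_listsI mem_Collect_eq set_mset_mset)
  then have "{S. wf_seq L S} \<subseteq> ?W \<times> ?W" by auto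
  moreover have "countable (?W \<times> ?W)"
    using countable_wf_fm[OF assms] by (intro countable_SIGMA countable_image countable_lists)
  ultimately show ?thesis by (rule countable_subset)
qed

lemma finite_set_tm: "finite (set_tm t)"
  by (induction t) auto

lemma finite_set_fm: "finite (set1_fm A)" "finite (set2_fm A)"
  by (induction A) (auto simp: finite_set_tm)

section \<open>Saturated sets of sequents\<close>

text \<open>Guarantees a fresh eigenvariable for the left quantifier rule.\<close>

lemma finite_fv_hyp: "finite (fv_hyp G)"
proof -
  have tm: "finite (fv_tm t)" for t :: "'a tm" by (induction t) auto
  have "finite (fv_fm A)" for A :: "('a, 'b) fm"
  proof (induction A)
    case (Exists A)
    then show ?case
      using finite_vimageI[of "fv_fm A" Suc] by (simp add: vimage_def)
  qed (auto simp: tm)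
  then show ?thesis by (auto simp: fv_hyp_def fv_seq_def)
qed

lemma wf_subst_tm: "wf_tm L t \<Longrightarrow> (\<And>i. wf_tm L (s i)) \<Longrightarrow> wf_tm L (subst_tm s t)"
  by (induction t) (auto simp: list_all_iff)

lemma wf_subst_fm: "wf_fm L A \<Longrightarrow> (\<And>i. wf_tm L (s i)) \<Longrightarrow> wf_fm L (subst_fm s A)"
proof (induction A arbitrary: s)
  case (Exists A)
  then show ?case by (auto simp: lift_subst_def wf_subst_tm split: nat.split)
qed (auto simp: list_all_iff wf_subst_tm)

lemma wf_inst: "wf_fm L A \<Longrightarrow> wf_tm L t \<Longrightarrow> wf_fm L (inst t A)"
  unfolding inst_def by (rule wf_subst_fm) (auto split: nat.split)

text \<open>The analogue of a maximal consistent Henkin set, with free variables as witnesses.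
  Membership in \<open>T\<close> will force value at least 0 in the term model.\<close>

locale saturated =
  fixes L :: "('f, 'r) signature" and T :: "('f, 'r) sequent set"
  assumes wf: "S \<in> T \<Longrightarrow> wf_seq L S"
    and underivable: "set_mset G \<subseteq> T \<Longrightarrow> \<not> derivable L G"
    and maximal: "wf_seq L S \<Longrightarrow> S \<notin> T \<Longrightarrow> \<exists>G. set_mset G \<subseteq> T \<and> derivable L (add_mset S G)"
    and witness: "(add_mset (Exists A) \<Gamma>, \<Delta>) \<in> T \<Longrightarrow> \<exists>c. (add_mset (inst (Var c) A) \<Gamma>, \<Delta>) \<in> T"
begin

lemma wf_hyp_subset: "set_mset G \<subseteq> T \<Longrightarrow> wf_hyp L G"
  using wf by (auto simp: wf_hyp_def)

text \<open>Common scheme for inverting a rule with premise \<open>S\<close> and conclusion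
  \<open>C\<close>: were \<open>S\<close> outside \<open>T\<close>, the derivation given by
  maximality could be continued to a hypersequent with all components in \<open>T\<close>.\<close>

lemma closed_unary:
  assumes "wf_seq L S" and "\<And>G. derivable L (add_mset S G) \<Longrightarrow> wf_hyp L G \<Longrightarrow> derivable L (G + C)"
    and "set_mset C \<subseteq> T"
  shows "S \<in> T"
proof (rule ccontr)
  assume "S \<notin> T"
  then obtain G where "set_mset G \<subseteq> T" "derivable L (add_mset S G)"
    using maximal assms(1) by blast
  then show False
    using assms(2)[of G] underivable[of "G + C"] assms(3) wf_hyp_subset by auto
qed

lemma add_closed:
  assumes "(\<Gamma>, \<Delta>) \<in> T" "(\<Gamma>', \<Delta>') \<in> T"
  shows "(\<Gamma> + \<Gamma>', \<Delta> + \<Delta>') \<in> T"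
  by (rule closed_unary[where C = "{#(\<Gamma>, \<Delta>), (\<Gamma>', \<Delta>')#}"])
    (use assms wf split[of L _ \<Gamma> \<Gamma>' \<Delta> \<Delta>'] in force)+

lemma imp_left_closed:
  assumes "(add_mset (Imp A B) \<Gamma>, \<Delta>) \<in> T"
  shows "(add_mset B \<Gamma>, add_mset A \<Delta>) \<in> T" "(\<Gamma>, \<Delta>) \<in> T"
proof -
  let ?S = "(add_mset B \<Gamma>, add_mset A \<Delta>)" and ?C = "{#(add_mset (Imp A B) \<Gamma>, \<Delta>)#}"
  have wf: "wf_seq L ?S" "wf_seq L (\<Gamma>, \<Delta>)" using wf[OF assms] by auto
  \<comment> \<open>The premise displays two components; deriving either one suffices, as (ew)
    supplies the other.\<close>
  have rule: "derivable L (G + ?C)" if "derivable L (G + {#?S, (\<Gamma>, \<Delta>)#})" for G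
    using imp_left that by blast
  show "?S \<in> T"
  proof (rule closed_unary[where C = ?C])
    fix G assume "derivable L (add_mset ?S G)"
    then show "derivable L (G + ?C)"
      using derivable_weaken[of L "add_mset ?S G" "{#(\<Gamma>, \<Delta>)#}"] wf
      by (intro rule) (simp add: add_mset_commute)
  qed (use assms wf in auto)
  show "(\<Gamma>, \<Delta>) \<in> T"
  proof (rule closed_unary[where C = ?C])
    fix G assume "derivable L (add_mset (\<Gamma>, \<Delta>) G)"
    then show "derivable L (G + ?C)"
      using derivable_weaken[of L "add_mset (\<Gamma>, \<Delta>) G" "{#?S#}"] wf
      by (intro rule) (simp add: add_mset_commute)
  qed (use assms wf in auto)
qed

lemma imp_right_closed:
  assumes "(\<Gamma>, add_mset (Imp A B) \<Delta>) \<in> T"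
  shows "(add_mset A \<Gamma>, add_mset B \<Delta>) \<in> T \<or> (\<Gamma>, \<Delta>) \<in> T"
proof (rule ccontr)
  let ?S = "(add_mset A \<Gamma>, add_mset B \<Delta>)"
  assume "\<not> ?thesis"
  moreover have "wf_seq L ?S" "wf_seq L (\<Gamma>, \<Delta>)" using wf[OF assms] by auto
  ultimately obtain G G' where G: "set_mset G \<subseteq> T" "derivable L (add_mset ?S G)"
    and G': "set_mset G' \<subseteq> T" "derivable L (add_mset (\<Gamma>, \<Delta>) G')"
    using maximal by metis
  \<comment> \<open>Both premises must share one side hypersequent, so the two contexts are merged
    by weakening.\<close>
  have "derivable L (G + G' + {#?S#})" "derivable L (G + G' + {#(\<Gamma>, \<Delta>)#})"
    using derivable_weaken[OF G(2) wf_hyp_subset[OF G'(1)]]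
      derivable_weaken[OF G'(2) wf_hyp_subset[OF G(1)]] by (simp_all add: add.commute)
  then have "derivable L (G + G' + {#(\<Gamma>, add_mset (Imp A B) \<Delta>)#})"
    by (rule imp_right)
  moreover have "set_mset (G + G' + {#(\<Gamma>, add_mset (Imp A B) \<Delta>)#}) \<subseteq> T"
    using G G' assms by auto
  ultimately show False using underivable by blast
qed

lemma ex_right_closed:
  assumes "(\<Gamma>, add_mset (Exists A) \<Delta>) \<in> T" "wf_tm L t"
  shows "(\<Gamma>, add_mset (inst t A) \<Delta>) \<in> T"
  by (rule closed_unary[where C = "{#(\<Gamma>, add_mset (Exists A) \<Delta>)#}"])
    (use assms wf[OF assms(1)] wf_inst ex_right[of L _ \<Gamma> t A \<Delta>] in auto)

end

text \<open>Stage \<open>k\<close> treats a pair of a sequent and a formula \<open>A\<close>. The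
  sequent is added if the result stays underivable, together with a witness if
  \<open>Exists A\<close> occurs in its antecedent. Enumerating pairs ensures that each existential
  formula of an antecedent is treated.\<close>

lemma ex_saturated:
  fixes L :: "('f, 'r) signature"
  assumes "countable (funs L)" "countable (rels L)" and H: "wf_hyp L H" "\<not> derivable L H"
  obtains T where "saturated L T" "set_mset H \<subseteq> T"
proof -
  define W :: "(('f, 'r) sequent \<times> ('f, 'r) fm) set"
    where "W = {S. wf_seq L S} \<times> {A. wf_fm L A}"
  have W: "countable W" "W \<noteq> {}"
    using countable_wf_seq countable_wf_fm assms(1,2) unfolding W_def
    by (auto intro!: exI[of _ "{#}"] exI[of _ Bot])
  define s where "s k = from_nat_into W k" for k
  have s_W: "s k \<in> W" for k using W(2) by (simp add: s_def from_nat_into)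
  define P where "P G \<longleftrightarrow> set_mset H \<subseteq> set_mset G \<and> wf_hyp L G \<and> \<not> derivable L G" for G
  define wit where "wit S A G \<longleftrightarrow> (\<forall>\<Gamma>. fst S = add_mset (Exists A) \<Gamma> \<longrightarrow>
    (\<exists>c. (add_mset (inst (Var c) A) \<Gamma>, snd S) \<in># G))"
    for S :: "('f, 'r) sequent" and A and G :: "('f, 'r) hypersequent"
  define Q where "Q k G G' \<longleftrightarrow> set_mset G \<subseteq> set_mset G' \<and>
    (derivable L (add_mset (fst (s k)) G) \<or> fst (s k) \<in># G' \<and> wit (fst (s k)) (snd (s k)) G')"
    for k and G G' :: "('f, 'r) hypersequent"
  have "\<exists>f. \<forall>k. P (f k) \<and> Q k (f k) (f (Suc k))"
  proof (rule dependent_nat_choice)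
    show "\<exists>G. P G" using H by (auto simp: P_def)
  next
    fix G :: "('f, 'r) hypersequent" and k :: nat
    assume G: "P G"
    obtain \<Pi> \<Delta> A where sk: "s k = ((\<Pi>, \<Delta>), A)" by (metis surj_pair)
    have wfS: "wf_seq L (\<Pi>, \<Delta>)" "wf_fm L A" using s_W[of k] sk by (auto simp: W_def)
    consider "derivable L (add_mset (\<Pi>, \<Delta>) G)"
      | "\<not> derivable L (add_mset (\<Pi>, \<Delta>) G)" "Exists A \<notin># \<Pi>"
      | \<Gamma> where "\<not> derivable L (add_mset (\<Pi>, \<Delta>) G)" "\<Pi> = add_mset (Exists A) \<Gamma>"
      by (metis multi_member_split)
    then show "\<exists>G'. P G' \<and> Q k G G'"
    proof cases
      case 1
      then show ?thesis using G by (auto simp: Q_def sk)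
    next
      case 2
      then have "P (add_mset (\<Pi>, \<Delta>) G) \<and> Q k G (add_mset (\<Pi>, \<Delta>) G)"
        using G wfS by (auto simp: P_def Q_def wit_def sk)
      then show ?thesis ..
    next
      case (3 \<Gamma>)
      let ?G = "add_mset (\<Pi>, \<Delta>) G"
      obtain c where c: "c \<notin> fv_hyp (?G + {#(\<Pi>, \<Delta>)#})"
        using finite_fv_hyp ex_new_if_finite infinite_UNIV_nat by blast
      let ?S = "(add_mset (inst (Var c) A) \<Gamma>, \<Delta>)"
      \<comment> \<open>The left quantifier rule with the fresh \<open>c\<close> would turn the
        witness sequent into a second copy of \<open>(\<Pi>, \<Delta>)\<close>, which (ec)
        removes.\<close>
      have "\<not> derivable L (?G + {#?S#})"
      proof
        assume "derivable L (?G + {#?S#})"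
        then have "derivable L (?G + {#(\<Pi>, \<Delta>)#})"
          using c ex_left unfolding 3(2) by blast
        then have "derivable L ?G" using ec[of L G \<Pi> \<Delta>] by simp
        then show False using 3 by simp
      qed
      moreover have "wf_seq L ?S" using wfS 3(2) by (auto intro: wf_inst)
      ultimately have "P (?G + {#?S#}) \<and> Q k G (?G + {#?S#})"
        using G wfS by (auto simp: P_def Q_def wit_def sk 3(2))
      then show ?thesis ..
    qed
  qed
  then obtain f where f: "\<And>k. P (f k)" "\<And>k. Q k (f k) (f (Suc k))" by blast
  define T where "T = (\<Union>k. set_mset (f k))"
  have mono: "set_mset (f k) \<subseteq> set_mset (f l)" if "k \<le> l" for k l
    using that by (rule lift_Suc_mono_le[rotated]) (use f(2) in \<open>auto simp: Q_def\<close>)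
  have wfT: "wf_seq L S" if "S \<in> T" for S
    using that f(1) by (auto simp: T_def P_def wf_hyp_def)
  have enum: "\<exists>k. s k = (S, A)" if "wf_seq L S" "wf_fm L A" for S A
    using from_nat_into_surj[OF W(1), of "(S, A)"] that by (simp add: s_def W_def)
  have underivT: "\<not> derivable L G" if "set_mset G \<subseteq> T" for G
  proof
    assume "derivable L G"
    \<comment> \<open>The finitely many components all occur by one stage.\<close>
    have "\<exists>k. set_mset G \<subseteq> set_mset (f k)" using that
    proof (induction G)
      case (add S G)
      then obtain k l where "set_mset G \<subseteq> set_mset (f k)" "S \<in># f l" by (auto simp: T_def)
      then have "set_mset (add_mset S G) \<subseteq> set_mset (f (max k l))"
        using mono[of k "max k l"] mono[of l "max k l"] by auto
      then show ?case by blast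
    qed simp
    then show False using f(1) derivable_mono \<open>derivable L G\<close> unfolding P_def by blast
  qed
  have "saturated L T"
  proof
    fix S assume "wf_seq L S" "S \<notin> T"
    then obtain k where "s k = (S, Bot)" using enum[of S Bot] by auto
    then have "derivable L (add_mset S (f k))"
      using f(2)[of k] \<open>S \<notin> T\<close> by (auto simp: Q_def T_def)
    then show "\<exists>G. set_mset G \<subseteq> T \<and> derivable L (add_mset S G)" by (auto simp: T_def)
  next
    fix A \<Gamma> \<Delta> assume S: "(add_mset (Exists A) \<Gamma>, \<Delta>) \<in> T" (is "?S \<in> T")
    then obtain k where k: "s k = (?S, A)" using enum[of ?S A] wfT by fastforce
    \<comment> \<open>A sequent of \<open>T\<close> cannot be rejected at any stage, so stage
      \<open>k\<close> provides the witness for \<open>A\<close>.\<close>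
    have "\<not> derivable L (add_mset ?S (f k))"
      using underivT[of "add_mset ?S (f k)"] S by (auto simp: T_def)
    then have "wit ?S A (f (Suc k))" using f(2)[of k] k by (simp add: Q_def)
    then show "\<exists>c. (add_mset (inst (Var c) A) \<Gamma>, \<Delta>) \<in> T" by (auto simp: wit_def T_def)
  qed (use wfT underivT in auto)
  moreover have "set_mset H \<subseteq> T" using f(1)[of 0] by (auto simp: P_def T_def)
  ultimately show thesis using that by blast
qed

section \<open>Semantics and the term model\<close>

lemma tm_val_subst: "tm_val M e (subst_tm s t) = tm_val M (\<lambda>i. tm_val M e (s i)) t"
  by (induction t) (auto simp: comp_def cong: map_cong)

lemma fm_val_subst: "fm_val M e (subst_fm s A) = fm_val M (\<lambda>i. tm_val M e (s i)) A"
proof (induction A arbitrary: e s)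
  case (Rel r ts)
  then show ?case by (simp add: tm_val_subst comp_def)
next
  case (Exists A)
  have "(\<lambda>i. tm_val M (case_nat m e) (lift_subst s i)) = case_nat m (\<lambda>i. tm_val M e (s i))" for m
    by (auto simp: fun_eq_iff lift_subst_def tm_val_subst split: nat.split)
  then show ?case by (simp add: Exists)
qed auto

lemma fm_val_inst: "fm_val M e (inst t A) = fm_val M (case_nat (tm_val M e t) e) A"
proof -
  have "(\<lambda>i. tm_val M e (case_nat t Var i)) = case_nat (tm_val M e t) e"
    by (auto simp: fun_eq_iff split: nat.split)
  then show ?thesis by (simp add: inst_def fm_val_subst)
qed

lemma tm_val_in_universe:
  assumes "unit_structure L M" "range e \<subseteq> universe M"
  shows "wf_tm L t \<Longrightarrow> tm_val M e t \<in> universe M"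
proof (induction t)
  case (Fun f ts)
  then have "set (map (tm_val M e) ts) \<subseteq> universe M" by (auto simp: list_all_iff)
  with Fun show ?case using assms(1) by (simp add: unit_structure_def)
qed (use assms in auto)

lemma fm_val_bounds:
  assumes M: "unit_structure L M"
  shows "wf_fm L A \<Longrightarrow> range e \<subseteq> universe M \<Longrightarrow> fm_val M e A \<in> {0..1}"
proof (induction A arbitrary: e)
  case (Rel r ts)
  then have "set (map (tm_val M e) ts) \<subseteq> universe M"
    using tm_val_in_universe[OF M] by (auto simp: list_all_iff)
  with Rel show ?case using M by (simp add: unit_structure_def)
next
  case (Imp A B)
  then have "fm_val M e A \<in> {0..1}" "fm_val M e B \<in> {0..1}" by auto
  then show ?case by auto
next
  case (Exists A)
  obtain m where m: "m \<in> universe M" using M by (auto simp: unit_structure_def)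
  have val: "fm_val M (case_nat m e) A \<in> {0..1}" if "m \<in> universe M" for m
  proof (rule Exists.IH)
    show "wf_fm L A" using Exists.prems by simp
    show "range (case_nat m e) \<subseteq> universe M"
      using that Exists.prems(2) by (auto simp: image_subset_iff split: nat.split)
  qed
  then have "bdd_below ((\<lambda>m. fm_val M (case_nat m e) A) ` universe M)"
    by (intro bdd_belowI[of _ 0]) auto
  then have "(INF m \<in> universe M. fm_val M (case_nat m e) A) \<le> 1"
    using cINF_lower2[OF _ m] val[OF m] by auto
  moreover have "0 \<le> (INF m \<in> universe M. fm_val M (case_nat m e) A)"
    using m val by (intro cINF_greatest) auto
  ultimately show ?case by simp
qed simp

text \<open>\<open>J\<close> carries terms into the type from which universes are drawn. Function symbols outside
  \<open>L\<close> get a default value, so that this is a structure for every signature extending \<open>L\<close>.\<close>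

definition term_struct ::
    "('f, 'r) signature \<Rightarrow> ('f tm \<Rightarrow> 'm) \<Rightarrow> (('f, 'r) fm \<Rightarrow> real) \<Rightarrow> ('f, 'r, 'm) struct" where
  "term_struct L J v =
     (let D = inv_into {t. wf_tm L t} J in
      \<lparr>universe = J ` {t. wf_tm L t},
       fun_int = \<lambda>f ms. J (if wf_tm L (Fun f (map D ms)) then Fun f (map D ms) else Var 0),
       rel_int = \<lambda>r ms. v (Rel r (map D ms))\<rparr>)"

lemma term_struct_unit:
  assumes "\<And>A. v A \<in> {0..1}"
  shows "unit_structure L' (term_struct L J v)"
  using assms by (auto simp: unit_structure_def term_struct_def Let_def simp del: wf_tm.simps(2)
      intro!: exI[of _ "Var 0"])

context
  fixes L :: "('f, 'r) signature" and J :: "'f tm \<Rightarrow> 'm" and v :: "('f, 'r) fm \<Rightarrow> real"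
  assumes inj: "inj_on J {t. wf_tm L t}"
begin

text \<open>On well-formed terms decoding inverts \<open>J\<close>, so each term denotes its own
  code.\<close>

lemma tm_val_term_struct: "wf_tm L t \<Longrightarrow> tm_val (term_struct L J v) (\<lambda>i. J (Var i)) t = J t"
proof (induction t)
  case (Fun f ts)
  then have "map (inv_into {t. wf_tm L t} J) (map (tm_val (term_struct L J v) (\<lambda>i. J (Var i))) ts) = ts"
    using inj by (auto simp: list_all_iff intro!: map_idI)
  then show ?case using Fun.prems by (simp add: term_struct_def Let_def del: map_map)
qed simp

lemma fm_val_term_struct_Rel:
  assumes "wf_fm L (Rel r ts)"
  shows "fm_val (term_struct L J v) (\<lambda>i. J (Var i)) (Rel r ts) = v (Rel r ts)"
proof -
  have "map (inv_into {t. wf_tm L t} J) (map (tm_val (term_struct L J v) (\<lambda>i. J (Var i))) ts) = ts"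
    using assms inj tm_val_term_struct by (auto simp: list_all_iff intro!: map_idI)
  then show ?thesis by (simp add: term_struct_def Let_def del: map_map)
qed

text \<open>All elements of the universe are codes of terms, so the infimum ranges over the
  instances that the quantifier rules provide.\<close>

lemma fm_val_term_struct_Exists:
  "fm_val (term_struct L J v) (\<lambda>i. J (Var i)) (Exists A) = (INF t \<in> {t. wf_tm L t}. fm_val (term_struct L J v) (\<lambda>i. J (Var i)) (inst t A))"
proof -
  have "universe (term_struct L J v) = J ` {t. wf_tm L t}" by (simp add: term_struct_def Let_def)
  moreover have "fm_val (term_struct L J v) (\<lambda>i. J (Var i)) (inst t A) = fm_val (term_struct L J v) (case_nat (J t) (\<lambda>i. J (Var i))) A"
    if "wf_tm L t" for t
    using that by (simp add: fm_val_inst tm_val_term_struct)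
  ultimately show ?thesis unfolding fm_val.simps by (auto simp: image_image intro!: INF_cong)
qed

end

text \<open>An induction measure that ignores terms, so instances of \<open>A\<close> count less
  than \<open>Exists A\<close> whatever term is substituted.\<close>

primrec connectives :: "('f, 'r) fm \<Rightarrow> nat" where
  "connectives (Rel r ts) = 0"
| "connectives Bot = 0"
| "connectives (Imp A B) = Suc (connectives A + connectives B)"
| "connectives (Exists A) = Suc (connectives A)"

lemma connectives_inst [simp]: "connectives (inst t A) = connectives A"
proof -
  have "connectives (subst_fm s A) = connectives A" for s
    by (induction A arbitrary: s) auto
  then show ?thesis by (simp add: inst_def)
qed

section \<open>Valuation of the atoms and the truth lemma\<close>

context saturated
begin

text \<open>Atoms are the coordinates, with \<open>Bot\<close> fixed at 1. Were a single atomic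
  sequent of \<open>T\<close> unsatisfiable, \<Gamma> would have enough surplus copies of
  \<open>Bot\<close> to pay for the surplus of \<Delta>, and the sequent would be derivable.\<close>

lemma atomic_valuation:
  assumes "countable (funs L)" "countable (rels L)"
  obtains v :: "('f, 'r) fm \<Rightarrow> real" where "v Bot = 1" "\<And>A. v A \<in> {0..1}"
    "\<And>\<Gamma> \<Delta>. (\<Gamma>, \<Delta>) \<in> T \<Longrightarrow> \<forall>A \<in># \<Gamma> + \<Delta>. connectives A = 0 \<Longrightarrow>
       (\<Sum>A \<in># \<Gamma>. v A) \<le> (\<Sum>A \<in># \<Delta>. v A)"
proof -
  let ?K = "{(\<Gamma>, \<Delta>) \<in> T. \<forall>A \<in># \<Gamma> + \<Delta>. connectives A = 0}"
  obtain v :: "('f, 'r) fm \<Rightarrow> real" where "v Bot = 1" "\<And>A. v A \<in> {0..1}"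
    "\<And>\<Gamma> \<Delta>. (\<Gamma>, \<Delta>) \<in> ?K \<Longrightarrow> (\<Sum>A \<in># \<Gamma>. v A) \<le> (\<Sum>A \<in># \<Delta>. v A)"
  proof (rule additive_forms_satisfiable[where K = ?K and u = Bot, OF countable_wf_fm[OF assms]])
    fix \<Gamma> \<Delta> assume K: "(\<Gamma>, \<Delta>) \<in> ?K"
    then have wfS: "wf_seq L (\<Gamma>, \<Delta>)" using wf by auto
    then show "set_mset (\<Gamma> + \<Delta>) \<subseteq> {A. wf_fm L A}" by auto
    show "0 \<le> partial_max (\<lambda>_. 1) {Bot} \<Gamma> \<Delta>"
    proof (rule ccontr)
      let ?F = "filter_mset (\<lambda>A. A \<noteq> Bot)"
      have Bots: "filter_mset (\<lambda>A. A \<in> {Bot}) M = replicate_mset (count M Bot) Bot"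
        for M :: "('f, 'r) fm multiset"
        by (intro multiset_eqI) auto
      assume "\<not> ?thesis"
      then have less: "count \<Delta> Bot + size (?F \<Delta> - ?F \<Gamma>) < count \<Gamma> Bot"
        unfolding partial_max_def Bots by simp
      \<comment> \<open>\<Gamma> has more copies of \<open>Bot\<close> than \<Delta>, so none is
        left in the difference.\<close>
      then have "\<Delta> - \<Gamma> = ?F \<Delta> - ?F \<Gamma>" by (intro multiset_eqI) auto
      then have "derivable L {#(\<Gamma>, \<Delta>)#}"
        using less wfS by (intro derivable_if_enough_bot) auto
      then show False using underivable[of "{#(\<Gamma>, \<Delta>)#}"] K by auto
    qed
  next
    fix \<Gamma> \<Delta> \<Gamma>' \<Delta>' assume "(\<Gamma>, \<Delta>) \<in> ?K" "(\<Gamma>', \<Delta>') \<in> ?K"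
    then show "(\<Gamma> + \<Gamma>', \<Delta> + \<Delta>') \<in> ?K" using add_closed by auto
  qed blast
  then show thesis using that by auto
qed

text \<open>The signature \<open>L'\<close> is arbitrary so that a model built for a sublanguage is
  also a structure for the full language.\<close>

lemma term_model:
  fixes J :: "'f tm \<Rightarrow> 'm"
  assumes "countable (funs L)" "countable (rels L)" and inj: "inj_on J {t. wf_tm L t}"
  obtains M :: "('f, 'r, 'm) struct" and e where "\<And>L'. unit_structure L' M" "range e \<subseteq> universe M"
    "\<And>S. S \<in> T \<Longrightarrow> 0 \<le> seq_val M e S"
proof -
  obtain v :: "('f, 'r) fm \<Rightarrow> real" where v: "v Bot = 1" "\<And>A. v A \<in> {0..1}"
    "\<And>\<Gamma> \<Delta>. (\<Gamma>, \<Delta>) \<in> T \<Longrightarrow> \<forall>A \<in># \<Gamma> + \<Delta>. connectives A = 0 \<Longrightarrow>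
       (\<Sum>A \<in># \<Gamma>. v A) \<le> (\<Sum>A \<in># \<Delta>. v A)"
    using atomic_valuation[OF assms(1,2)] by blast
  let ?M = "term_struct L J v" and ?e = "\<lambda>i. J (Var i)"
  let ?V = "fm_val ?M ?e"
  have unit: "unit_structure L' ?M" for L' :: "('f, 'r) signature"
    using v(2) by (rule term_struct_unit)
  have e: "range ?e \<subseteq> universe ?M" by (auto simp: term_struct_def Let_def)
  have bounds: "?V A \<in> {0..1}" if "wf_fm L A" for A
    using fm_val_bounds[OF unit that e] .
  have atom: "?V A = v A" if "wf_fm L A" "connectives A = 0" for A
    using that v(1) fm_val_term_struct_Rel[OF inj] by (cases A) auto
  have inst_bounds: "?V (inst t A) \<in> {0..1}" if "wf_fm L A" "wf_tm L t" for A t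
    using that by (intro bounds wf_inst)
  have ex_le: "?V (Exists A) \<le> ?V (inst t A)" if "wf_fm L A" "wf_tm L t" for A t
    unfolding fm_val_term_struct_Exists[OF inj]
    using that inst_bounds by (intro cINF_lower bdd_belowI[of _ 0]) auto
  have ex_ge: "x \<le> ?V (Exists A)" if "\<And>t. wf_tm L t \<Longrightarrow> x \<le> ?V (inst t A)" for A x
    unfolding fm_val_term_struct_Exists[OF inj]
    using that by (intro cINF_greatest) (auto intro: exI[of _ "Var 0"])
  have "(\<Sum>A \<in># \<Gamma>. ?V A) \<le> (\<Sum>A \<in># \<Delta>. ?V A)" if "(\<Gamma>, \<Delta>) \<in> T" for \<Gamma> \<Delta>
    using that
  proof (induction "\<Sum>A \<in># \<Gamma> + \<Delta>. connectives A" arbitrary: \<Gamma> \<Delta> rule: less_induct)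
    case less
    note wfS = wf[OF less.prems]
    consider "\<forall>A \<in># \<Gamma> + \<Delta>. connectives A = 0"
      | A where "A \<in># \<Gamma>" "connectives A \<noteq> 0" | A where "A \<in># \<Delta>" "connectives A \<noteq> 0"
      by auto
    then show ?case
    proof cases
      case 1
      have "image_mset ?V \<Gamma> = image_mset v \<Gamma>" "image_mset ?V \<Delta> = image_mset v \<Delta>"
        using 1 wfS atom by (auto intro!: image_mset_cong)
      then show ?thesis using v(3)[OF less.prems 1] by simp
    next
      case (2 C)
      then obtain \<Gamma>' where \<Gamma>: "\<Gamma> = add_mset C \<Gamma>'" by (meson multi_member_split)
      show ?thesis
      proof (cases C)
        case (Imp A B)
        \<comment> \<open>The two sequents correspond to the two arguments of the maximum defining
          the value of \<open>Imp A B\<close>; either may be the larger one.\<close>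
        note closed = imp_left_closed[OF less.prems[unfolded \<Gamma> Imp]]
        show ?thesis
          using less.hyps[OF _ closed(1)] less.hyps[OF _ closed(2)] by (simp add: \<Gamma> Imp max_def)
      next
        case (Exists A)
        obtain c where c: "(add_mset (inst (Var c) A) \<Gamma>', \<Delta>) \<in> T"
          using witness[OF less.prems[unfolded \<Gamma> Exists]] by blast
        \<comment> \<open>The infimum is at most the value at the witness, and lowering the
          left-hand sum preserves the inequality.\<close>
        have "?V C \<le> ?V (inst (Var c) A)" using ex_le[of A "Var c"] wfS by (simp add: \<Gamma> Exists)
        then show ?thesis using less.hyps[OF _ c] by (simp add: \<Gamma> Exists del: fm_val.simps)
      qed (use 2 in auto)
    next
      case (3 C)
      then obtain \<Delta>' where \<Delta>: "\<Delta> = add_mset C \<Delta>'" by (meson multi_member_split)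
      show ?thesis
      proof (cases C)
        case (Imp A B)
        \<comment> \<open>The value of \<open>Imp A B\<close> is at least both arguments of its
          maximum, so either alternative suffices.\<close>
        from imp_right_closed[OF less.prems[unfolded \<Delta> Imp]] show ?thesis
        proof
          assume "(add_mset A \<Gamma>, add_mset B \<Delta>') \<in> T"
          from less.hyps[OF _ this] show ?thesis by (simp add: \<Delta> Imp max_def)
        next
          assume "(\<Gamma>, \<Delta>') \<in> T"
          from less.hyps[OF _ this] show ?thesis by (simp add: \<Delta> Imp max_def)
        qed
      next
        case (Exists A)
        \<comment> \<open>A lower bound common to all instances passes to their infimum.\<close>
        have "(\<Sum>A \<in># \<Gamma>. ?V A) - (\<Sum>A \<in># \<Delta>'. ?V A) \<le> ?V (inst t A)" if "wf_tm L t" for t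
          using less.hyps[OF _ ex_right_closed[OF less.prems[unfolded \<Delta> Exists] that]]
          by (simp add: \<Delta> Exists)
        from ex_ge[OF this] show ?thesis by (simp add: \<Delta> Exists del: fm_val.simps)
      qed (use 3 in auto)
    qed
  qed
  then have "0 \<le> seq_val ?M ?e S" if "S \<in> T" for S
    using that by (cases S) (simp add: seq_val_def)
  then show thesis using that[OF unit e] by blast
qed

end

section \<open>Reduction to a countable sublanguage and conclusion\<close>

lemma derivable_sublanguage:
  assumes "funs L \<subseteq> funs L'" "rels L \<subseteq> rels L'" "fun_arity L = fun_arity L'"
    "rel_arity L = rel_arity L'" and "derivable L G"
  shows "derivable L' G"
proof -
  have tm: "wf_tm L t \<Longrightarrow> wf_tm L' t" for t
    using assms(1-4) by (induction t) (auto simp: list_all_iff)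
  have fm: "wf_fm L A \<Longrightarrow> wf_fm L' A" for A
    using assms(1-4) tm by (induction A) (auto simp: list_all_iff)
  show ?thesis
    using assms(5)
  proof (induction rule: derivable.induct)
    case (init_id A)
    then show ?case using fm by (blast intro: derivable.init_id)
  next
    case init_empty
    show ?case by (rule derivable.init_empty)
  next
    case (init_bot A)
    then show ?case using fm by (blast intro: derivable.init_bot)
  next
    case (ec G \<Gamma> \<Delta>)
    then show ?case by (blast intro: derivable.ec)
  next
    case (ew G \<Gamma> \<Delta> \<Gamma>' \<Delta>')
    then have "wf_seq L' (\<Gamma>', \<Delta>')" using fm by simp
    with ew show ?case by (blast intro: derivable.ew)
  next
    case (split G \<Gamma>\<^sub>0 \<Gamma>\<^sub>1 \<Delta>\<^sub>0 \<Delta>\<^sub>1)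
    then show ?case by (blast intro: derivable.split)
  next
    case (mix G \<Gamma>\<^sub>0 \<Delta>\<^sub>0 \<Gamma>\<^sub>1 \<Delta>\<^sub>1)
    then show ?case by (blast intro: derivable.mix)
  next
    case (wl G \<Gamma> \<Delta> A)
    then show ?case using fm by (blast intro: derivable.wl)
  next
    case (imp_left G B \<Gamma> A \<Delta>)
    then show ?case by (blast intro: derivable.imp_left)
  next
    case (imp_right G A \<Gamma> B \<Delta>)
    then show ?case by (blast intro: derivable.imp_right)
  next
    case (ex_left G c A \<Gamma> \<Delta>)
    then show ?case by (blast intro: derivable.ex_left)
  next
    case (ex_right G \<Gamma> t A \<Delta>)
    then show ?case using tm by (blast intro: derivable.ex_right)
  qed
qed

theorem mainTheorem1:
  fixes L :: "('f, 'r) signature"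
    and H :: "('f, 'r) hypersequent"
    and n :: nat
  assumes "infinite (UNIV :: 'm set)"
    and "wf_hyp L H"
    and "fv_hyp H = {}"
    and "valid TYPE('m) L H"
  shows "derivable L (approx_hyp n H)"
proof (rule ccontr)
  assume underiv: "\<not> derivable L (approx_hyp n H)"
  define Fs where "Fs = {A. \<exists>S \<in># H. A \<in># fst S + snd S}"
  have "finite Fs"
  proof -
    have "Fs = (\<Union>S \<in> set_mset H. set_mset (fst S + snd S))" by (auto simp: Fs_def)
    then show ?thesis by simp
  qed
  \<comment> \<open>The signature \<open>L\<close> may be uncountable, while the construction
    enumerates sequents; \<open>L\<^sub>0\<close> keeps only the finitely many symbols that occur in
    \<open>H\<close>.\<close>
  define L\<^sub>0 where "L\<^sub>0 = L\<lparr>funs := funs L \<inter> (\<Union>A \<in> Fs. set1_fm A),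
    rels := rels L \<inter> (\<Union>A \<in> Fs. set2_fm A)\<rparr>"
  have countable: "countable (funs L\<^sub>0)" "countable (rels L\<^sub>0)"
    using \<open>finite Fs\<close> by (auto simp: L\<^sub>0_def finite_set_fm intro!: countable_finite)
  have tm: "wf_tm L\<^sub>0 t" if "wf_tm L t" "set_tm t \<subseteq> funs L\<^sub>0" for t
    using that
  proof (induction t)
    case (Fun f ts)
    then have "list_all (wf_tm L\<^sub>0) ts" by (fastforce simp: list_all_iff)
    with Fun.prems show ?case by (simp add: L\<^sub>0_def)
  qed simp
  have fm: "wf_fm L\<^sub>0 A" if "wf_fm L A" "set1_fm A \<subseteq> funs L\<^sub>0" "set2_fm A \<subseteq> rels L\<^sub>0" for A
    using that
  proof (induction A)
    case (Rel r ts)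
    then have "list_all (wf_tm L\<^sub>0) ts" using tm by (fastforce simp: list_all_iff)
    with Rel show ?case by (simp add: L\<^sub>0_def)
  qed auto
  have "wf_fm L\<^sub>0 A" if "A \<in> Fs" for A
  proof (rule fm)
    show A: "wf_fm L A" using that assms(2) by (auto simp: Fs_def wf_hyp_def wf_seq_def)
    show "set1_fm A \<subseteq> funs L\<^sub>0" "set2_fm A \<subseteq> rels L\<^sub>0"
      using set_fm_wf[OF A] that by (auto simp: L\<^sub>0_def)
  qed
  moreover have "A \<in># repeat_mset n M \<Longrightarrow> A \<in># M" for A and M :: "('f, 'r) fm multiset"
    by (simp flip: count_greater_zero_iff)
  ultimately have "wf_hyp L\<^sub>0 (approx_hyp n H)"
    unfolding wf_hyp_def wf_seq_def approx_hyp_def approx_seq_def Fs_def by fastforce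
  moreover have "\<not> derivable L\<^sub>0 (approx_hyp n H)"
  proof
    assume "derivable L\<^sub>0 (approx_hyp n H)"
    then have "derivable L (approx_hyp n H)"
      by (rule derivable_sublanguage[rotated 4]) (simp_all add: L\<^sub>0_def)
    then show False using underiv by contradiction
  qed
  ultimately obtain T where "saturated L\<^sub>0 T" and T: "set_mset (approx_hyp n H) \<subseteq> T"
    using ex_saturated[OF countable] by metis
  then interpret saturated L\<^sub>0 T by simp
  \<comment> \<open>An infinite type contains a copy of \<open>nat\<close>, hence room for the
    countably many terms over \<open>L\<^sub>0\<close>.\<close>
  obtain g :: "nat \<Rightarrow> 'm" where "inj g"
    using infinite_countable_subset[OF assms(1)] by blast
  then have "inj_on (g \<circ> to_nat_on {t. wf_tm L\<^sub>0 t}) {t. wf_tm L\<^sub>0 t}"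
    using countable_wf_tm[OF countable(1)] by (intro comp_inj_on inj_on_to_nat_on) (auto intro: inj_on_subset)
  from term_model[OF countable this] obtain M :: "('f, 'r, 'm) struct" and e where
    M: "\<And>L'. unit_structure L' M" "range e \<subseteq> universe M" "\<And>S. S \<in> T \<Longrightarrow> 0 \<le> seq_val M e S"
    by blast
  have pos: "0 < seq_val M e S" if "S \<in># H" for S
  proof -
    have "sum_mset (image_mset f (repeat_mset n G)) = real n * sum_mset (image_mset f G)"
      for f :: "('f, 'r) fm \<Rightarrow> real" and G
      by (induction n) (auto simp: algebra_simps)
    \<comment> \<open>The single extra \<open>Bot\<close> in the antecedent contributes the
      -1.\<close>
    then have "seq_val M e (approx_seq n S) = real n * seq_val M e S - 1"
      by (simp add: seq_val_def approx_seq_def algebra_simps)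
    moreover have "approx_seq n S \<in> T" using T that by (auto simp: approx_hyp_def)
    ultimately have "1 \<le> real n * seq_val M e S" using M(3) by fastforce
    \<comment> \<open>A nonpositive value of \<open>S\<close> would make the product nonpositive,
      for \<open>n = 0\<close> as well.\<close>
    then show ?thesis
      using mult_nonneg_nonpos[of "real n" "seq_val M e S"] by (cases "0 < seq_val M e S") auto
  qed
  have "H \<noteq> {#}" "hyp_val M e H \<le> 0" using assms(4) M by (auto simp: valid_def)
  then obtain S where "S \<in># H" "seq_val M e S \<le> 0" by (auto simp: hyp_val_def Min_le_iff)
  then show False using pos[of S] by simp
qed

end
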